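(* Let $\kappa$ be continuous, let $\eta\in GS$ be continuous, and let $\psi$ be differentiable, not identically zero, with $\psi(0)\ne 0$. Suppose $K$ is a continuous solution of $$K(x+y\eta(x))-K(y)=\psi(y)\kappa(x)\qquad(x,y\in\mathbb{R}).\qquad (GBE\text{-}P)$$ Then either $K$ is constant or: (i) $K$ is differentiable and $K'(x)\equiv\kappa'(0)/f(x)$ for $f(x):=\eta(x)/\psi(x)$; (ii) $\kappa'(x)/\kappa'(0)\equiv K'(x)/K'(0)$, and $\kappa(x)=c\,\tau_f(x)$ for some $c\in\mathbb{R}$; (iii) $K_0':=K'/K'(0)$ is a homomorphism from $(\mathbb{R},\circ_\eta)$ to $(\mathbb{R},\cdot)$: $$K_0'(x+y\eta(x))=K_0'(x)K_0'(y).$$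
   Context: $GS$ denotes the family of functions $\eta(x)=1+\rho x$ with $\rho\ge0$. $x\circ_\eta y:=x+y\eta(x)$. For $f=\eta/\psi$, $\tau_f(x):=\int_0^x du/f(u)$, with $1/f$ meaning $\psi/\eta$. Identities involving division by $\eta(x)$ are read at points where $\eta(x)\neq0$ (in particular they are meaningful on $\mathbb{R}_+=[0,\infty)$). *)

theory Defs
  imports "HOL-Analysis.Analysis"
begin

definition GS :: "(real \<Rightarrow> real) set" where
  "GS = {\<eta>. \<exists>\<rho>\<ge>0. \<forall>x. \<eta> x = 1 + \<rho> * x}"

definition popa_circ :: "(real \<Rightarrow> real) \<Rightarrow> real \<Rightarrow> real \<Rightarrow> real" where
  "popa_circ \<eta> x y = x + y * \<eta> x"

text \<open>
  The interval integral is oriented, so \<open>x < 0\<close> is covered.  For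
  \<open>f = \<eta> / \<psi>\<close> the total division of HOL makes \<open>1 / f u\<close> coincide with \<open>\<psi> u / \<eta> u\<close>
  at every \<open>u\<close>, zeros of \<open>\<psi>\<close> included.  Its value at a zero of \<open>\<eta>\<close> is the default \<open>0\<close>;
  this is at most one point for \<open>\<eta> \<in> GS\<close>, so it does not affect the integral.
\<close>
definition tau :: "(real \<Rightarrow> real) \<Rightarrow> real \<Rightarrow> real" where
  "tau f x = (LBINT u=ereal 0..ereal x. 1 / f u)"

text \<open>A homomorphism from the reals with \<open>popa_circ \<eta>\<close> to the multiplicative monoid of the reals.\<close>
definition popa_hom :: "(real \<Rightarrow> real) \<Rightarrow> (real \<Rightarrow> real) \<Rightarrow> bool" where
  "popa_hom \<eta> h \<longleftrightarrow> (\<forall>x y. h (popa_circ \<eta> x y) = h x * h y)"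

end

theory Submission
  imports Defs
begin

text \<open>
  Write \<open>\<eta> x = 1 + \<rho> * x\<close> and \<open>x \<circ> y = x + y * \<eta> x\<close>, an operation that is symmetric in
  \<open>x\<close> and \<open>y\<close>.  For \<open>\<rho> \<noteq> 0\<close> the zero \<open>p = - 1 / \<rho>\<close> of \<open>\<eta>\<close> (the pole of \<open>1 / \<eta>\<close>) is absorbing:
  \<open>p \<circ> y = p\<close>.

  Once a non-constant \<open>K\<close> is known to be differentiable, everything follows by differentiating the
  equation in \<open>x\<close>.  Setting \<open>y = 0\<close> in the equation gives \<open>K x = K 0 + \<psi> 0 * \<kappa> x\<close>, so \<open>\<kappa>'\<close> is
  proportional to \<open>K'\<close>.  The differentiated equation \<open>K' (x \<circ> y) * \<eta> y = \<psi> y * \<kappa>' x\<close> yields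
  \<open>K' y * \<eta> y = \<psi> y * \<kappa>' 0\<close> at \<open>x = 0\<close>, and eliminating \<open>\<psi>\<close> between the two gives
  multiplicativity of \<open>K' / K' 0\<close> after cancelling a factor \<open>\<eta> y\<close>.

  Differentiability of \<open>K\<close> (lemma \<open>K_differentiable\<close>) is obtained differently for \<open>\<rho> \<noteq> 0\<close> and
  \<open>\<rho> = 0\<close>.  If \<open>\<rho> \<noteq> 0\<close>, setting \<open>x = p\<close> expresses \<open>K\<close> as an affine function of the differentiable
  function \<open>\<psi>\<close>.  If \<open>\<rho> = 0\<close>, integrating the equation over \<open>x\<close> in \<open>[0, 1]\<close> expresses \<open>K y\<close> through
  \<open>\<psi> y\<close> and increments of an antiderivative of \<open>K\<close>.

  What remains is the behaviour at \<open>p\<close>, where \<open>\<eta>\<close> cannot be cancelled.  A continuous function with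
  zero derivative off \<open>p\<close> is still constant; this gives \<open>K' 0 \<noteq> 0\<close> and, with multiplicativity off
  \<open>p\<close>, a dichotomy: either \<open>K' p = 0\<close>, or \<open>K'\<close> is constant (lemma
  \<open>deriv_K_constant_of_nonzero_at_pole\<close>).  Multiplicativity at \<open>p\<close> is immediate in either case.  So
  is continuity of \<open>K'\<close> at \<open>p\<close> in the second case, and in the first it follows from the affine
  relation between \<open>K\<close> and \<open>\<psi>\<close>.  With \<open>K'\<close> continuous, the fundamental theorem of calculus gives
  \<open>\<kappa> = c * tau f\<close>.
\<close>

lemma DERIV_zero_off_point_imp_const:
  fixes F :: "real \<Rightarrow> real"
  assumes cont: "continuous_on UNIV F"
    and deriv: "\<And>x. x \<noteq> p \<Longrightarrow> (F has_real_derivative 0) (at x)"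
  shows "F x = F y"
proof (rule has_derivative_zero_unique_strong_connected
      [where f = F and x = x and S = UNIV and K = "{p}" and c = y])
  show "(F has_derivative (\<lambda>h. 0)) (at z within UNIV)" if "z \<in> UNIV - {p}" for z
    using deriv[of z] that by (simp add: has_field_derivative_def lambda_zero)
qed (use cont in auto)

section \<open>Differentiability of K\<close>

locale goldie_equation =
  fixes K \<kappa> \<psi> :: "real \<Rightarrow> real" and \<rho> :: real
  assumes equation: "\<And>x y. K (x + y * (1 + \<rho> * x)) - K y = \<psi> y * \<kappa> x"
    and cont_K: "continuous_on UNIV K"
    and nonconst: "\<not> K constant_on UNIV"
    and diff_psi: "\<And>x. \<psi> field_differentiable (at x)"
    and psi_0: "\<psi> 0 \<noteq> 0"
begin

lemma K_eq: "K x = K 0 + \<psi> 0 * \<kappa> x"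
  using equation[of x 0] by simp

lemma kappa_eq: "\<kappa> x = (K x - K 0) / \<psi> 0"
  using K_eq[of x] psi_0 by simp

text \<open>
  Since \<open>- 1 / \<rho>\<close> is absorbing, \<open>x = - 1 / \<rho>\<close> removes \<open>y\<close> from the first term of the equation.
\<close>
lemma K_affine_in_psi:
  assumes "\<rho> \<noteq> 0"
  shows "\<kappa> (- 1 / \<rho>) \<noteq> 0" and "K y = K (- 1 / \<rho>) - \<kappa> (- 1 / \<rho>) * \<psi> y"
proof -
  have K: "K y = K (- 1 / \<rho>) - \<kappa> (- 1 / \<rho>) * \<psi> y" for y
    using equation[of "- 1 / \<rho>" y] assms by (simp add: algebra_simps)
  show "K y = K (- 1 / \<rho>) - \<kappa> (- 1 / \<rho>) * \<psi> y" by (rule K)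
  show "\<kappa> (- 1 / \<rho>) \<noteq> 0"
  proof
    assume "\<kappa> (- 1 / \<rho>) = 0"
    then have "K y = K (- 1 / \<rho>)" for y
      using K[of y] by simp
    then show False
      using nonconst unfolding constant_on_def by blast
  qed
qed

lemma K_differentiable: "K field_differentiable (at x)"
proof (cases "\<rho> = 0")
  case False
  have "(\<lambda>y. K (- 1 / \<rho>) - \<kappa> (- 1 / \<rho>) * \<psi> y) field_differentiable (at x)"
    by (intro derivative_intros diff_psi)
  then show ?thesis
    by (rule back_subst[of "\<lambda>f. f field_differentiable (at x)"])
      (rule ext, rule K_affine_in_psi(2)[OF False, symmetric])
next
  case True
  obtain G where G: "\<And>x. (G has_real_derivative K x) (at x)"
  proof -
    have "\<exists>F. \<forall>x. - \<infinity> < ereal x \<longrightarrow> ereal x < \<infinity> \<longrightarrow> (F has_vector_derivative K x) (at x)"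
      using cont_K by (intro einterval_antiderivative) (auto simp: continuous_on_eq_continuous_at)
    then show thesis
      using that by (auto simp: has_real_derivative_iff_has_vector_derivative)
  qed
  have eq: "K (x + y) - K y = \<psi> y * \<kappa> x" for x y
    using equation[of x y] True by simp
  define Q where "Q x = (G x - K 0 * x) / \<psi> 0" for x
  have Q: "(Q has_real_derivative \<kappa> x) (at x)" for x
    unfolding Q_def kappa_eq[of x] using psi_0 by (auto intro!: derivative_eq_intros G)
  have K: "K y = G (1 + y) - G y - \<psi> y * (Q 1 - Q 0)" for y
  proof -
    have shift: "((\<lambda>x. G (x + y)) has_real_derivative K (x + y)) (at x)" for x
      using G[of "x + y"] by (simp add: DERIV_shift)
    \<comment> \<open>The equation says that this function of \<open>x\<close> has derivative zero.\<close>
    let ?D = "\<lambda>x. G (x + y) - K y * x - \<psi> y * Q x"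
    have D: "(?D has_real_derivative 0) (at x)" for x
      using eq[of x y] by (auto intro!: derivative_eq_intros shift Q)
    have "?D 1 = ?D 0"
      by (rule DERIV_isconst_all) (use D in blast)
    then show ?thesis by (simp add: algebra_simps)
  qed
  have shift: "((\<lambda>y. G (1 + y)) has_real_derivative K (1 + x)) (at x)"
    using G[of "x + 1"] DERIV_shift[of G "K (1 + x)" x 1] by (simp add: add.commute)
  have "(\<lambda>y. G (1 + y) - G y - \<psi> y * (Q 1 - Q 0)) field_differentiable (at x)"
    by (intro derivative_intros diff_psi) (use shift G field_differentiable_def in blast)+
  then show ?thesis
    by (rule back_subst[of "\<lambda>f. f field_differentiable (at x)"]) (rule ext, rule K[symmetric])
qed

lemma has_deriv_K: "(K has_real_derivative deriv K x) (at x)"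
  using K_differentiable by (simp add: field_differentiable_derivI)

lemma has_deriv_kappa: "(\<kappa> has_real_derivative deriv K x / \<psi> 0) (at x)"
proof -
  have "((\<lambda>x. (K x - K 0) / \<psi> 0) has_real_derivative deriv K x / \<psi> 0) (at x)"
    using psi_0 by (auto intro!: derivative_eq_intros has_deriv_K)
  then show ?thesis
    by (rule back_subst[of "\<lambda>f. (f has_real_derivative _) (at x)"])
      (rule ext, rule kappa_eq[symmetric])
qed

lemma deriv_kappa: "deriv \<kappa> x = deriv K x / \<psi> 0"
  using has_deriv_kappa by (rule DERIV_imp_deriv)

section \<open>The differentiated equation\<close>

text \<open>
  The derivative of the equation in \<open>x\<close>; the factor \<open>1 + \<rho> * y\<close> comes from the chain rule
  applied to \<open>x + y * (1 + \<rho> * x)\<close>.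
\<close>
lemma differentiated_equation:
  "deriv K (x + y * (1 + \<rho> * x)) * (1 + \<rho> * y) = \<psi> y * deriv \<kappa> x"
proof -
  have inner: "((\<lambda>x. x + y * (1 + \<rho> * x)) has_real_derivative 1 + \<rho> * y) (at x)"
    by (auto intro!: derivative_eq_intros simp: algebra_simps)
  have "((\<lambda>x. K (x + y * (1 + \<rho> * x)) - K y) has_real_derivative
      deriv K (x + y * (1 + \<rho> * x)) * (1 + \<rho> * y)) (at x)"
    using DERIV_diff[OF DERIV_chain2[OF has_deriv_K inner] DERIV_const] by simp
  moreover have "((\<lambda>x. \<psi> y * \<kappa> x) has_real_derivative \<psi> y * (deriv K x / \<psi> 0)) (at x)"
    by (intro DERIV_cmult has_deriv_kappa)
  ultimately show ?thesis
    unfolding equation deriv_kappa by (rule DERIV_unique)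
qed

lemma deriv_K_times_eta: "deriv K y * (1 + \<rho> * y) = \<psi> y * deriv \<kappa> 0"
  using differentiated_equation[of 0 y] by simp

lemma off_pole: "x \<noteq> - 1 / \<rho> \<Longrightarrow> 1 + \<rho> * x \<noteq> 0"
  by (cases "\<rho> = 0") (auto simp: field_simps add_eq_0_iff)

text \<open>
  If \<open>K' 0 = 0\<close>, then \<open>K' y * \<eta> y\<close> vanishes identically, so \<open>K' = 0\<close> off the pole and \<open>K\<close> would
  be constant.
\<close>
lemma deriv_K_0_nonzero: "deriv K 0 \<noteq> 0"
proof
  assume "deriv K 0 = 0"
  then have "deriv K x = 0" if "x \<noteq> - 1 / \<rho>" for x
    using deriv_K_times_eta[of x] off_pole[OF that] by (simp add: deriv_kappa)
  then have "(K has_real_derivative 0) (at x)" if "x \<noteq> - 1 / \<rho>" for x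
    using has_deriv_K[of x] that by simp
  then have "K x = K y" for x y
    by (rule DERIV_zero_off_point_imp_const[OF cont_K])
  then show False
    using nonconst unfolding constant_on_def by blast
qed

lemma deriv_kappa_0_nonzero: "deriv \<kappa> 0 \<noteq> 0"
  using deriv_K_0_nonzero psi_0 by (simp add: deriv_kappa)

lemma deriv_K_mult_off_pole:
  assumes "1 + \<rho> * y \<noteq> 0"
  shows "deriv K 0 * deriv K (x + y * (1 + \<rho> * x)) = deriv K x * deriv K y"
proof -
  have "deriv K (x + y * (1 + \<rho> * x)) * (1 + \<rho> * y) * deriv K 0
      = (deriv K y * (1 + \<rho> * y)) * deriv K x"
    unfolding differentiated_equation deriv_K_times_eta by (simp add: deriv_kappa)
  then have "(1 + \<rho> * y) * (deriv K 0 * deriv K (x + y * (1 + \<rho> * x)))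
      = (1 + \<rho> * y) * (deriv K x * deriv K y)"
    by (simp only: ac_simps)
  then show ?thesis
    using assms by simp
qed

text \<open>
  For \<open>x\<close> off the pole \<open>p\<close>, absorption turns multiplicativity into \<open>K' 0 * K' p = K' p * K' x\<close>.
  Cancelling \<open>K' p\<close> leaves \<open>K' x = K' 0\<close>, so \<open>K\<close> is affine.
\<close>
lemma deriv_K_constant_of_nonzero_at_pole:
  assumes "\<rho> \<noteq> 0" and "deriv K (- 1 / \<rho>) \<noteq> 0"
  shows "deriv K x = deriv K 0"
proof -
  let ?p = "- 1 / \<rho>"
  have off: "deriv K x = deriv K 0" if "x \<noteq> ?p" for x
    using deriv_K_mult_off_pole[OF off_pole[OF that], of ?p] assms by simp
  have affine: "K x - deriv K 0 * x = K 0" for x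
  proof -
    have "K x - deriv K 0 * x = K 0 - deriv K 0 * 0"
    proof (rule DERIV_zero_off_point_imp_const[where F = "\<lambda>x. K x - deriv K 0 * x"])
      show "continuous_on UNIV (\<lambda>x. K x - deriv K 0 * x)"
        by (intro continuous_intros cont_K)
      show "((\<lambda>x. K x - deriv K 0 * x) has_real_derivative 0) (at x)" if "x \<noteq> ?p" for x
        using off[OF that] by (auto intro!: derivative_eq_intros has_deriv_K)
    qed
    then show ?thesis by simp
  qed
  have "K 0 + deriv K 0 * x = K x" for x
    using affine[of x] by simp
  moreover have "((\<lambda>x. K 0 + deriv K 0 * x) has_real_derivative deriv K 0) (at x)"
    by (auto intro!: derivative_eq_intros)
  ultimately have "(K has_real_derivative deriv K 0) (at x)"
    by (simp only:)
  then show ?thesis by (rule DERIV_imp_deriv)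
qed

lemma deriv_K_mult:
  "deriv K 0 * deriv K (x + y * (1 + \<rho> * x)) = deriv K x * deriv K y"
proof -
  consider "1 + \<rho> * y \<noteq> 0" | "1 + \<rho> * x \<noteq> 0" | "1 + \<rho> * x = 0" "1 + \<rho> * y = 0"
    by blast
  then show ?thesis
  proof cases
    case 1
    then show ?thesis by (rule deriv_K_mult_off_pole)
  next
    case 2
    have "x + y * (1 + \<rho> * x) = y + x * (1 + \<rho> * y)"
      by (simp add: algebra_simps)
    then show ?thesis
      using deriv_K_mult_off_pole[OF 2, of y] by (simp add: mult.commute)
  next
    case 3
    \<comment> \<open>Here \<open>x = y = p\<close>, and the claim reads \<open>K' 0 * K' p = K' p * K' p\<close>.\<close>
    then have "\<rho> \<noteq> 0" by auto
    with 3 have xy: "x = - 1 / \<rho>" "y = - 1 / \<rho>"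
      by (auto simp: field_simps add_eq_0_iff)
    show ?thesis
      using deriv_K_constant_of_nonzero_at_pole[OF \<open>\<rho> \<noteq> 0\<close>, of "- 1 / \<rho>"] xy \<open>\<rho> \<noteq> 0\<close>
      by (cases "deriv K (- 1 / \<rho>) = 0") auto
  qed
qed

section \<open>Continuity of the derivative and the integral of psi over eta\<close>

text \<open>
  Off the pole, \<open>K' = \<kappa>' 0 * \<psi> / \<eta>\<close> is continuous.  At the pole \<open>p\<close> only the case \<open>K' p = 0\<close> needs an
  argument: there \<open>\<psi>\<close> is proportional to \<open>K - K p\<close> and \<open>\<eta>\<close> to \<open>x - p\<close>, so \<open>K' x\<close> is a constant
  multiple of the difference quotient of \<open>K\<close> at \<open>p\<close> and tends to \<open>0\<close>.
\<close>
lemma continuous_deriv_K: "continuous_on UNIV (deriv K)"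
proof -
  have off: "deriv K x = deriv \<kappa> 0 * \<psi> x / (1 + \<rho> * x)" if "1 + \<rho> * x \<noteq> 0" for x
    using deriv_K_times_eta[of x] that by (simp add: field_simps)
  have "isCont (deriv K) x" for x
  proof (cases "1 + \<rho> * x = 0")
    case False
    have "isCont \<psi> x"
      using diff_psi field_differentiable_imp_continuous_at by blast
    then have lim: "isCont (\<lambda>x. deriv \<kappa> 0 * \<psi> x / (1 + \<rho> * x)) x"
      using False by (intro continuous_intros) auto
    have "open {x. 1 + \<rho> * x \<noteq> 0}"
      by (intro open_Collect_neq continuous_intros)
    then have "\<forall>\<^sub>F x in nhds x. 1 + \<rho> * x \<noteq> 0"
      using False by (auto simp: eventually_nhds)
    then have "\<forall>\<^sub>F x in nhds x. deriv K x = deriv \<kappa> 0 * \<psi> x / (1 + \<rho> * x)"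
      by eventually_elim (rule off)
    then show ?thesis
      using lim by (simp add: isCont_cong)
  next
    case True
    then have rho: "\<rho> \<noteq> 0" by auto
    with True have x: "x = - 1 / \<rho>"
      by (auto simp: field_simps add_eq_0_iff)
    show ?thesis
    proof (cases "deriv K x = 0")
      case False
      then have "deriv K = (\<lambda>_. deriv K 0)"
        using deriv_K_constant_of_nonzero_at_pole[OF rho] x by blast
      then show ?thesis by (metis continuous_const)
    next
      case zero: True
      define C where "C = - deriv \<kappa> 0 / (\<kappa> x * \<rho>)"
      have quotient: "deriv K z = C * ((K z - K x) / (z - x))" if "z \<noteq> x" for z
      proof -
        have eta: "1 + \<rho> * z = \<rho> * (z - x)"
          using True by (simp add: algebra_simps)
        have psi: "\<psi> z = - (K z - K x) / \<kappa> x" and "\<kappa> x \<noteq> 0"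
          using K_affine_in_psi(1)[OF rho] K_affine_in_psi(2)[OF rho, of z]
          unfolding x by (simp_all add: field_simps)
        then show ?thesis
          using off[of z] that rho unfolding eta C_def psi by (simp add: field_simps)
      qed
      have "((\<lambda>z. (K z - K x) / (z - x)) \<longlongrightarrow> 0) (at x)"
        using has_deriv_K[of x] zero by (simp add: has_field_derivative_iff)
      then have "((\<lambda>z. C * ((K z - K x) / (z - x))) \<longlongrightarrow> C * 0) (at x)"
        by (rule tendsto_mult_left)
      then have "(deriv K \<longlongrightarrow> 0) (at x)"
        using quotient by (auto simp: eventually_at_filter elim!: Lim_transform_eventually)
      then show ?thesis
        using zero by (simp add: isCont_def)
    qed
  qed
  then show ?thesis
    by (simp add: continuous_at_imp_continuous_on)
qed

text \<open>
  The integrand \<open>\<psi> / \<eta>\<close> agrees almost everywhere with the continuous function \<open>K' / \<kappa>' 0\<close>, which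
  has the antiderivative \<open>K / \<kappa>' 0\<close>.
\<close>
lemma psi_over_eta_integral:
  shows "interval_lebesgue_integrable lborel (ereal 0) (ereal x) (\<lambda>u. \<psi> u / (1 + \<rho> * u))"
    and "(LBINT u=ereal 0..ereal x. \<psi> u / (1 + \<rho> * u)) = (K x - K 0) / deriv \<kappa> 0"
proof -
  let ?g = "\<lambda>u. deriv K u / deriv \<kappa> 0"
  have cont: "continuous_on UNIV ?g"
    using deriv_kappa_0_nonzero by (intro continuous_intros continuous_deriv_K) auto
  have cont_psi: "continuous_on UNIV \<psi>"
    by (meson continuous_at_imp_continuous_on diff_psi field_differentiable_imp_continuous_at)
  have [measurable]: "?g \<in> borel_measurable borel" "\<psi> \<in> borel_measurable borel"
    using cont cont_psi by (auto intro: borel_measurable_continuous_onI)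
  have ae: "AE u in lborel. \<psi> u / (1 + \<rho> * u) = ?g u"
    using AE_lborel_singleton[of "- 1 / \<rho>"]
  proof eventually_elim
    case (elim u)
    then show ?case
      using deriv_K_times_eta[of u] off_pole[OF elim] deriv_kappa_0_nonzero
      by (simp add: field_simps)
  qed
  have cont_on: "continuous_on S ?g" for S
    using cont continuous_on_subset by blast
  have "interval_lebesgue_integrable lborel (ereal 0) (ereal x) ?g"
  proof (cases "0 \<le> x")
    case True
    then show ?thesis by (intro interval_integrable_continuous_on cont_on)
  next
    case False
    then show ?thesis
      by (subst interval_integrable_endpoints_reverse)
        (intro interval_integrable_continuous_on cont_on, simp)
  qed
  moreover have "interval_lebesgue_integrable lborel (ereal 0) (ereal x) (\<lambda>u. \<psi> u / (1 + \<rho> * u))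
      \<longleftrightarrow> interval_lebesgue_integrable lborel (ereal 0) (ereal x) ?g"
    by (rule interval_lebesgue_integrable_cong_AE) (use ae in auto)
  ultimately show "interval_lebesgue_integrable lborel (ereal 0) (ereal x)
      (\<lambda>u. \<psi> u / (1 + \<rho> * u))"
    by blast
  have "(LBINT u=ereal 0..ereal x. \<psi> u / (1 + \<rho> * u)) = (LBINT u=ereal 0..ereal x. ?g u)"
    by (rule interval_integral_cong_AE) (use ae in auto)
  also have "\<dots> = K x / deriv \<kappa> 0 - K 0 / deriv \<kappa> 0"
  proof (rule interval_integral_FTC_finite[OF cont_on])
    show "((\<lambda>u. K u / deriv \<kappa> 0) has_vector_derivative ?g u) (at u within S)" for u S
      unfolding has_real_derivative_iff_has_vector_derivative[symmetric]
      by (intro DERIV_cdivide has_field_derivative_at_within[OF has_deriv_K])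
  qed
  finally show "(LBINT u=ereal 0..ereal x. \<psi> u / (1 + \<rho> * u)) = (K x - K 0) / deriv \<kappa> 0"
    by (simp add: diff_divide_distrib)
qed

end

section \<open>The solutions of the equation\<close>

theorem theorem2:
  fixes K \<kappa> \<eta> \<psi> :: "real \<Rightarrow> real"
  assumes "continuous_on UNIV \<kappa>"
    and "\<eta> \<in> GS" and "continuous_on UNIV \<eta>"
    and "\<psi> differentiable_on UNIV" and "\<exists>x. \<psi> x \<noteq> 0" and "\<psi> 0 \<noteq> 0"
    and "continuous_on UNIV K"
    and "\<forall>x y. K (x + y * \<eta> x) - K y = \<psi> y * \<kappa> x"
  shows "K constant_on UNIV \<or>
    (let f = (\<lambda>x. \<eta> x / \<psi> x) in
      (K differentiable_on UNIV \<and>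
       (\<forall>x. \<eta> x \<noteq> 0 \<longrightarrow> deriv K x = deriv \<kappa> 0 / f x)) \<and>
      (\<kappa> differentiable_on UNIV \<and> deriv \<kappa> 0 \<noteq> 0 \<and> deriv K 0 \<noteq> 0 \<and>
       (\<forall>x. deriv \<kappa> x / deriv \<kappa> 0 = deriv K x / deriv K 0) \<and>
       (\<forall>x. interval_lebesgue_integrable lborel (ereal 0) (ereal x) (\<lambda>u. 1 / f u)) \<and>
       (\<exists>c. \<forall>x. \<kappa> x = c * tau f x)) \<and>
      popa_hom \<eta> (\<lambda>x. deriv K x / deriv K 0))"
proof (cases "K constant_on UNIV")
  case False
  from assms(2) obtain \<rho> where eta: "\<eta> = (\<lambda>x. 1 + \<rho> * x)"
    unfolding GS_def by blast
  interpret goldie_equation K \<kappa> \<psi> \<rho>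
  proof
    show "K (x + y * (1 + \<rho> * x)) - K y = \<psi> y * \<kappa> x" for x y
      using assms(8) by (simp add: eta)
    show "\<psi> field_differentiable (at x)" for x
      using assms(4)
      by (simp add: differentiable_on_def real_differentiable_def field_differentiable_def)
  qed (use assms False in auto)
  let ?f = "\<lambda>x. \<eta> x / \<psi> x"
  have "K differentiable_on UNIV" "\<kappa> differentiable_on UNIV"
    using has_deriv_K has_deriv_kappa
    by (meson differentiable_at_withinI differentiable_on_def real_differentiable_def)+
  moreover have "deriv K x = deriv \<kappa> 0 / ?f x" if "\<eta> x \<noteq> 0" for x
    using deriv_K_times_eta[of x] that by (simp add: eta field_simps)
  moreover have "deriv \<kappa> x / deriv \<kappa> 0 = deriv K x / deriv K 0" for x
    using psi_0 by (simp add: deriv_kappa)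
  moreover have "interval_lebesgue_integrable lborel (ereal 0) (ereal x) (\<lambda>u. 1 / ?f u)" for x
    using psi_over_eta_integral(1) by (simp add: eta)
  moreover have "\<kappa> x = deriv \<kappa> 0 / \<psi> 0 * tau ?f x" for x
    using psi_over_eta_integral(2)[of x] deriv_kappa_0_nonzero
    by (simp add: tau_def eta kappa_eq)
  moreover have "popa_hom \<eta> (\<lambda>x. deriv K x / deriv K 0)"
    using deriv_K_mult deriv_K_0_nonzero
    by (simp add: popa_hom_def popa_circ_def eta field_simps)
  ultimately show ?thesis
    unfolding Let_def using deriv_kappa_0_nonzero deriv_K_0_nonzero by blast
qed simp

end
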